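(* Let $G$ be a connected co-biconvex graph without universal vertices, with partition $(C_1,C_2)$ and auxiliary interval graphs $H_1,H_2$ as described in the context, and let $\alpha_i$ be the independence number of $H_i$ for $i\in\{1,2\}$. Let $k$ be a positive integer with $k\leq\delta(G)+1$. Then: (i) if $\alpha_i=1$ and $D$ is a $k$-tuple dominating set of $G$, then $|D\cap C_j|\geq k$, where $\{i,j\}=\{1,2\}$; (ii) if $\alpha_1+\alpha_2=2$, then $\gamma_{\times k}(G)=2k$; (iii) if $\alpha_1+\alpha_2>k$, then $\gamma_{\times k}(G)=k+1$; (iv) if $\alpha_1+\alpha_2=k$ and $|C_i|\geq\alpha_i+1$ for $i\in\{1,2\}$, then $\gamma_{\times k}(G)=k+2$.
   Context: For a graph $G$ with vertices $v_1,\dots,v_n$, the augmented adjacency matrix $M^*(G)$ has entry $(i,j)$ equal to $1$ iff $i=j$ or $v_iv_j\in E(G)$. $G$ is co-biconvex if the rows of $M^*(G)$ can be permuted so the 0's in every column are consecutive. Fix an ordering $v_1,\dots,v_n$ (rows and columns of $M^*(G)$ in this order) in which the 0's of each column are consecutive; let $C_1$ be the set of vertices whose column has its 0's below the main diagonal, $C_2$ those whose column has its 0's above the main diagonal (columns without 0's correspond to universal vertices; here there are none). Then $C_1,C_2$ partition $V(G)$, are cliques, and we may take $C_1=\{v_1,\dots,v_r\}$, $C_2=\{v_{r+1},\dots,v_n\}$. Auxiliary graphs: for $v_i\in C_1$, if the 0's of column $i$ occupy rows $p,\dots,p+s$ (with $r+1\leq p$, $p+s\leq n$), let $I_i=[p,p+s]$;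 for $v_i\in C_2$, if the 0's of column $i$ occupy rows $p,\dots,p+s$ (with $1\le p$, $p+s\leq r$), let $I_i=[p,p+s]$. $H_1$ is the intersection graph of $\{I_i: v_i\in C_1\}$ (vertex set $C_1$) and $H_2$ that of $\{I_i:v_i\in C_2\}$ (vertex set $C_2$). Equivalently, two vertices of $C_1$ are adjacent in $H_1$ iff some vertex of $C_2$ is non-adjacent in $G$ to both (symmetrically for $H_2$). $N_G[v]$ is the closed neighborhood; $D$ is a $k$-tuple dominating set if $|N_G[v]\cap D|\geq k$ for all $v$; $\gamma_{\times k}(G)$ is the minimum size of such a set; $\delta(G)$ is the minimum degree. *)

theory Defs
  imports
    "Graph_Theory.Pair_Digraph"
    "Graph_Theory.Digraph_Component"
    "HOL-Combinatorics.Permutations"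
begin

text \<open>
  A finite simple graph is a \<^locale>\<open>pair_graph\<close>: finitely many vertices, no loops, and a symmetric
  arc relation, so that each edge uv is present as both arcs (u,v) and (v,u).
\<close>

section \<open>Neighbourhoods, degrees and tuple domination\<close>

definition closed_nbhd :: "'a pair_pre_digraph \<Rightarrow> 'a \<Rightarrow> 'a set" where
  "closed_nbhd G v = insert v {u. (v, u) \<in> parcs G}"

definition universal_vertex :: "'a pair_pre_digraph \<Rightarrow> 'a \<Rightarrow> bool" where
  "universal_vertex G v \<longleftrightarrow> v \<in> pverts G \<and> (\<forall>u\<in>pverts G. u \<noteq> v \<longrightarrow> (v, u) \<in> parcs G)"

text \<open>The arc relation being symmetric, the out-degree of a vertex is its degree.\<close>

definition min_degree :: "'a pair_pre_digraph \<Rightarrow> nat" where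
  "min_degree G = Min ((\<lambda>v. out_degree (with_proj G) v) ` pverts G)"

definition tuple_dominating :: "'a pair_pre_digraph \<Rightarrow> nat \<Rightarrow> 'a set \<Rightarrow> bool" where
  "tuple_dominating G k D \<longleftrightarrow>
     D \<subseteq> pverts G \<and> (\<forall>v\<in>pverts G. k \<le> card (closed_nbhd G v \<inter> D))"

text \<open>
  Only meaningful if some such set exists, that is, if \<open>k \<le> min_degree G + 1\<close>.
\<close>

definition tuple_domination_number :: "'a pair_pre_digraph \<Rightarrow> nat \<Rightarrow> nat" where
  "tuple_domination_number G k = (LEAST m. \<exists>D. tuple_dominating G k D \<and> card D = m)"

definition independent_set :: "'a pair_pre_digraph \<Rightarrow> 'a set \<Rightarrow> bool" where
  "independent_set H S \<longleftrightarrow> S \<subseteq> pverts H \<and> (\<forall>u\<in>S. \<forall>w\<in>S. (u, w) \<notin> parcs H)"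

definition independence_number :: "'a pair_pre_digraph \<Rightarrow> nat" where
  "independence_number H = Max {card S | S. independent_set H S}"

section \<open>Co-biconvex graphs\<close>

text \<open>
  A numbering \<open>v\<close> lists the vertices as \<open>v 1, \<dots>, v n\<close>; the augmented adjacency matrix has rows and
  columns indexed by \<open>{1..n}\<close> in this order.
\<close>

definition numbering :: "'a pair_pre_digraph \<Rightarrow> (nat \<Rightarrow> 'a) \<Rightarrow> bool" where
  "numbering G v \<longleftrightarrow> bij_betw v {1..card (pverts G)} (pverts G)"

definition aug_adj :: "'a pair_pre_digraph \<Rightarrow> (nat \<Rightarrow> 'a) \<Rightarrow> nat \<Rightarrow> nat \<Rightarrow> nat" where
  "aug_adj G v i j = (if i = j \<or> (v i, v j) \<in> parcs G then 1 else 0)"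

text \<open>A column without zeros counts as having consecutive zeros (take \<open>q < p\<close>).\<close>

definition consecutive :: "nat set \<Rightarrow> bool" where
  "consecutive Z \<longleftrightarrow> (\<exists>p q. Z = {p..q})"

definition co_biconvex :: "'a pair_pre_digraph \<Rightarrow> bool" where
  "co_biconvex G \<longleftrightarrow>
     (\<exists>v \<pi>. numbering G v \<and> \<pi> permutes {1..card (pverts G)} \<and>
        (\<forall>j\<in>{1..card (pverts G)}.
           consecutive {i \<in> {1..card (pverts G)}. aug_adj G v (\<pi> i) j = 0}))"

definition zero_rows :: "'a pair_pre_digraph \<Rightarrow> (nat \<Rightarrow> 'a) \<Rightarrow> nat \<Rightarrow> nat set" where
  "zero_rows G v j = {i \<in> {1..card (pverts G)}. aug_adj G v i j = 0}"

definition co_biconvex_ordering :: "'a pair_pre_digraph \<Rightarrow> (nat \<Rightarrow> 'a) \<Rightarrow> bool" where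
  "co_biconvex_ordering G v \<longleftrightarrow>
     numbering G v \<and> (\<forall>j\<in>{1..card (pverts G)}. consecutive (zero_rows G v j))"

text \<open>
  Whether all columns have consecutive zeros does not depend on the order of the columns, so a row
  permutation as above may be applied to the columns too, which amounts to renumbering the vertices.
\<close>

lemma co_biconvex_iff_ordering: "co_biconvex G \<longleftrightarrow> (\<exists>v. co_biconvex_ordering G v)"
proof
  let ?N = "{1..card (pverts G)}"
  assume "co_biconvex G"
  then obtain v \<pi> where v: "bij_betw v ?N (pverts G)" and \<pi>: "\<pi> permutes ?N"
    and c: "\<And>j. j \<in> ?N \<Longrightarrow> consecutive {i \<in> ?N. aug_adj G v (\<pi> i) j = 0}"
    unfolding co_biconvex_def numbering_def by blast
  have "consecutive (zero_rows G (v \<circ> \<pi>) j)" if j: "j \<in> ?N" for j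
  proof -
    have "\<pi> i = \<pi> j \<longleftrightarrow> i = j" for i
      using permutes_inj[OF \<pi>] by (auto dest: injD)
    then have "zero_rows G (v \<circ> \<pi>) j = {i \<in> ?N. aug_adj G v (\<pi> i) (\<pi> j) = 0}"
      by (simp add: zero_rows_def aug_adj_def)
    then show ?thesis
      using c[of "\<pi> j"] permutes_in_image[OF \<pi>, of j] j by simp
  qed
  moreover have "numbering G (v \<circ> \<pi>)"
    unfolding numbering_def using bij_betw_trans[OF permutes_imp_bij[OF \<pi>] v] .
  ultimately show "\<exists>v. co_biconvex_ordering G v"
    unfolding co_biconvex_ordering_def by blast
next
  assume "\<exists>v. co_biconvex_ordering G v"
  then obtain v where "co_biconvex_ordering G v" ..
  then show "co_biconvex G"
    unfolding co_biconvex_def co_biconvex_ordering_def zero_rows_def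
    by (intro exI[of _ v] exI[of _ id]) (simp add: permutes_id)
qed

section \<open>The cliques and the auxiliary interval graphs\<close>

text \<open>
  Vertices whose column has its zeros below (\<open>clique1\<close>) or above (\<open>clique2\<close>) the main diagonal. A
  column without zeros, i.e. that of a universal vertex, is in neither. It is not required that the
  vertices of \<open>clique1\<close> come first in the numbering; listing \<open>clique1\<close> before \<open>clique2\<close>, each in the
  given order, turns any co-biconvex ordering (without universal vertices) into one of that form with the same cliques and auxiliary graphs.
\<close>

definition clique1 :: "'a pair_pre_digraph \<Rightarrow> (nat \<Rightarrow> 'a) \<Rightarrow> 'a set" where
  "clique1 G v = {v j | j. j \<in> {1..card (pverts G)} \<and> zero_rows G v j \<noteq> {} \<and>
                           (\<forall>i\<in>zero_rows G v j. j < i)}"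

definition clique2 :: "'a pair_pre_digraph \<Rightarrow> (nat \<Rightarrow> 'a) \<Rightarrow> 'a set" where
  "clique2 G v = {v j | j. j \<in> {1..card (pverts G)} \<and> zero_rows G v j \<noteq> {} \<and>
                           (\<forall>i\<in>zero_rows G v j. i < j)}"

text \<open>
  The interval from the first to the last zero row of column \<open>j\<close>, for a column that has zeros.
  Intervals with integer endpoints meet over the reals iff they meet in an integer, so intervals of
  naturals suffice.
\<close>

definition column_interval :: "'a pair_pre_digraph \<Rightarrow> (nat \<Rightarrow> 'a) \<Rightarrow> nat \<Rightarrow> nat set" where
  "column_interval G v j = {Min (zero_rows G v j)..Max (zero_rows G v j)}"

definition interval_graph_on ::
  "'a pair_pre_digraph \<Rightarrow> (nat \<Rightarrow> 'a) \<Rightarrow> 'a set \<Rightarrow> 'a pair_pre_digraph" where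
  "interval_graph_on G v C =
     \<lparr> pverts = C,
       parcs = {(v i, v j) | i j.
                  i \<in> {1..card (pverts G)} \<and> j \<in> {1..card (pverts G)} \<and>
                  v i \<in> C \<and> v j \<in> C \<and> i \<noteq> j \<and>
                  column_interval G v i \<inter> column_interval G v j \<noteq> {}} \<rparr>"

definition aux_graph1 :: "'a pair_pre_digraph \<Rightarrow> (nat \<Rightarrow> 'a) \<Rightarrow> 'a pair_pre_digraph" where
  "aux_graph1 G v = interval_graph_on G v (clique1 G v)"

definition aux_graph2 :: "'a pair_pre_digraph \<Rightarrow> (nat \<Rightarrow> 'a) \<Rightarrow> 'a pair_pre_digraph" where
  "aux_graph2 G v = interval_graph_on G v (clique2 G v)"

end

theory Submission
  imports Defs
begin

text \<open>
  Writing \<open>M x\<close> for the set of non-neighbours of \<open>x\<close>, a set \<open>D\<close> is \<open>k\<close>-tuple dominating iff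
  \<open>k + \<bar>D \<inter> M x\<bar> \<le> \<bar>D\<bar>\<close> for all \<open>x\<close>. The sets \<open>M x\<close> are intervals in the given ordering, and
  two vertices are adjacent in an auxiliary graph iff their sets \<open>M\<close> meet; hence \<open>D \<inter> C\<^sub>i\<close> is
  independent in \<open>H\<^sub>i\<close> iff it meets every \<open>M x\<close> in at most one vertex. A set with \<open>\<bar>D\<bar> = k + 1\<close> is
  therefore dominating iff both parts are independent, and \<open>k + 2\<close> leaves room for one extra vertex
  on each side. If \<open>\<alpha>\<^sub>i = 1\<close>, the Helly property of intervals gives a vertex \<open>u\<close> non-adjacent to all
  of \<open>C\<^sub>i\<close>, so the closed neighbourhood of \<open>u\<close> is the other clique.
\<close>

section \<open>Extremal values: independence number, domination number, minimum degree\<close>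

lemma independent_set_le_independence_number:
  assumes "finite (pverts H)" "independent_set H S"
  shows "card S \<le> independence_number H"
proof -
  \<comment> \<open>The sizes must form a finite set before \<open>Max\<close> can bound its
    members.\<close>
  have "{card S | S. independent_set H S} \<subseteq> card ` Pow (pverts H)"
    unfolding independent_set_def by blast
  then have "finite {card S | S. independent_set H S}"
    by (rule finite_subset) (simp add: assms(1))
  then show ?thesis
    unfolding independence_number_def using assms(2) by (intro Max_ge) auto
qed

lemma independence_number_attained:
  assumes "finite (pverts H)"
  obtains S where "independent_set H S" "card S = independence_number H"
proof -
  have "{card S | S. independent_set H S} \<subseteq> card ` Pow (pverts H)"
    unfolding independent_set_def by blast
  then have "finite {card S | S. independent_set H S}"
    by (rule finite_subset) (simp add: assms)
  \<comment> \<open>The empty set makes the set of sizes nonempty, so \<open>Max\<close> is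
    attained.\<close>
  moreover have "independent_set H {}"
    by (simp add: independent_set_def)
  ultimately have "independence_number H \<in> {card S | S. independent_set H S}"
    unfolding independence_number_def by (intro Max_in) auto
  then show ?thesis
    using that by auto
qed

lemma tuple_domination_number_eqI:
  assumes "tuple_dominating G k D" "card D = m"
    and "\<And>D'. tuple_dominating G k D' \<Longrightarrow> m \<le> card D'"
  shows "tuple_domination_number G k = m"
  unfolding tuple_domination_number_def using assms by (intro Least_equality) auto

text \<open>Without loops, a closed neighbourhood has one element more than the degree. This is how
  \<open>k \<le> min_degree G + 1\<close> will guarantee \<open>k\<close> vertices in each
  clique.\<close>

lemma (in pair_graph) card_closed_nbhd:
  assumes "x \<in> pverts G"
  shows "min_degree G + 1 \<le> card (closed_nbhd G x)"
proof -
  have fin: "finite {u. (x, u) \<in> parcs G}"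
    by (rule finite_subset[OF _ pair_finite_verts]) (use in_arcsD2 in blast)
  have "out_arcs (with_proj G) x = Pair x ` {u. (x, u) \<in> parcs G}"
    by (auto simp: out_arcs_def)
  then have "out_degree (with_proj G) x = card {u. (x, u) \<in> parcs G}"
    by (simp add: out_degree_def card_image inj_on_def)
  moreover have "min_degree G \<le> out_degree (with_proj G) x"
    unfolding min_degree_def using assms by (intro Min_le) auto
  moreover have "x \<notin> {u. (x, u) \<in> parcs G}"
    using pair_no_loops by fastforce
  ultimately show ?thesis
    using fin by (simp add: closed_nbhd_def)
qed

lemma Min_atLeastAtMost_nat: "p \<le> q \<Longrightarrow> Min {p..q} = p" for p q :: nat
  by (rule Min_eqI) auto

lemma Max_atLeastAtMost_nat: "p \<le> q \<Longrightarrow> Max {p..q} = q" for p q :: nat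
  by (rule Max_eqI) auto

section \<open>Non-neighbourhoods as intervals of rows\<close>

locale co_biconvex_graph = pair_graph G for G :: "'a pair_pre_digraph" +
  fixes v :: "nat \<Rightarrow> 'a"
  assumes ordering: "co_biconvex_ordering G v"
    and no_universal: "\<not> universal_vertex G x"
begin

abbreviation "V \<equiv> pverts G"
abbreviation "n \<equiv> card V"
abbreviation "C1 \<equiv> clique1 G v"
abbreviation "C2 \<equiv> clique2 G v"

text \<open>The zero set of the column of \<open>x\<close>, read as vertices instead of row indices;
  \<open>x\<close> itself is excluded, like the diagonal of the matrix.\<close>

definition non_nbhd :: "'a \<Rightarrow> 'a set" where
  "non_nbhd x = V - closed_nbhd G x"

lemma bij_v: "bij_betw v {1..n} V"
  using ordering by (simp add: co_biconvex_ordering_def numbering_def)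

lemma v_eq_iff: "i \<in> {1..n} \<Longrightarrow> j \<in> {1..n} \<Longrightarrow> v i = v j \<longleftrightarrow> i = j"
  using bij_v by (auto simp: bij_betw_def dest: inj_onD)

lemma v_in: "i \<in> {1..n} \<Longrightarrow> v i \<in> V"
  using bij_v by (auto simp: bij_betw_def)

lemma obtain_index:
  assumes "x \<in> V" obtains i where "i \<in> {1..n}" "x = v i"
  using assms bij_betw_imp_surj_on[OF bij_v] by blast

lemma non_nbhd_subset: "non_nbhd x \<subseteq> V"
  by (auto simp: non_nbhd_def)

lemma finite_non_nbhd [simp]: "finite (non_nbhd x)"
  by (simp add: non_nbhd_def)

lemma non_nbhd_sym: "x \<in> V \<Longrightarrow> y \<in> non_nbhd x \<Longrightarrow> x \<in> non_nbhd y"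
  by (auto simp: non_nbhd_def closed_nbhd_def dest: arcs_symmetric)

lemma non_nbhd_nonempty: "x \<in> V \<Longrightarrow> non_nbhd x \<noteq> {}"
  using no_universal[of x] by (auto simp: non_nbhd_def closed_nbhd_def universal_vertex_def)

text \<open>The dictionary between rows and vertices. The matrix entry tests the arc from
  \<open>v i\<close> to \<open>v j\<close>, the closed neighbourhood the reverse arc, so symmetry is
  used.\<close>

lemma mem_zero_rows_iff:
  assumes "i \<in> {1..n}" "j \<in> {1..n}"
  shows "i \<in> zero_rows G v j \<longleftrightarrow> v i \<in> non_nbhd (v j)"
  using assms v_eq_iff[OF assms] v_in[of i]
  by (auto simp: zero_rows_def aug_adj_def non_nbhd_def closed_nbhd_def dest: arcs_symmetric)

lemma zero_rows_subset: "zero_rows G v j \<subseteq> {1..n}"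
  by (auto simp: zero_rows_def)

lemma zero_rows_nonempty: "j \<in> {1..n} \<Longrightarrow> zero_rows G v j \<noteq> {}"
  using non_nbhd_nonempty[of "v j"] v_in[of j] non_nbhd_subset[of "v j"]
  by (metis ex_in_conv mem_zero_rows_iff obtain_index subsetD)

text \<open>Without universal vertices every column has a zero, so the degenerate case
  \<open>q < p\<close> of \<open>consecutive\<close> is excluded and both endpoints are genuine
  zeros.\<close>

lemma zero_rows_eq_atLeastAtMost:
  assumes "j \<in> {1..n}"
  obtains p q where "p \<le> q" "zero_rows G v j = {p..q}"
  using ordering assms zero_rows_nonempty[OF assms]
  unfolding co_biconvex_ordering_def consecutive_def by (metis atLeastatMost_empty_iff)

lemma column_interval_eq: "j \<in> {1..n} \<Longrightarrow> column_interval G v j = zero_rows G v j"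
  by (erule zero_rows_eq_atLeastAtMost)
    (simp add: column_interval_def Min_atLeastAtMost_nat Max_atLeastAtMost_nat)

section \<open>The partition into two cliques\<close>

text \<open>The diagonal entry is 1, so the interval of zeros misses row \<open>j\<close> and cannot
  extend to both sides of it.\<close>

lemma clique_cases:
  assumes "x \<in> V"
  shows "x \<in> C1 \<or> x \<in> C2"
proof -
  obtain j where j: "j \<in> {1..n}" "x = v j"
    using assms by (rule obtain_index)
  obtain p q where Z: "zero_rows G v j = {p..q}"
    using j(1) by (rule zero_rows_eq_atLeastAtMost)
  have "j \<notin> zero_rows G v j"
    by (simp add: zero_rows_def aug_adj_def)
  then have "(\<forall>i\<in>zero_rows G v j. j < i) \<or> (\<forall>i\<in>zero_rows G v j. i < j)"
    unfolding Z by auto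
  then show ?thesis
    using j zero_rows_nonempty[OF j(1)] by (auto simp: clique1_def clique2_def)
qed

lemma cliques_disjoint: "C1 \<inter> C2 = {}"
proof -
  have False if x: "x \<in> C1" "x \<in> C2" for x
  proof -
    obtain j where j: "j \<in> {1..n}" "x = v j" "zero_rows G v j \<noteq> {}"
        "\<forall>i\<in>zero_rows G v j. j < i"
      using x(1) unfolding clique1_def by blast
    obtain j' where j': "j' \<in> {1..n}" "x = v j'" "\<forall>i\<in>zero_rows G v j'. i < j'"
      using x(2) unfolding clique2_def by blast
    have "j' = j"
      using v_eq_iff[OF j(1) j'(1)] j(2) j'(2) by simp
    then show False
      using j j' by fastforce
  qed
  then show ?thesis by blast
qed

lemma clique1_subset: "C1 \<subseteq> V"
  using v_in by (auto simp: clique1_def)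

lemma clique2_subset: "C2 \<subseteq> V"
  using v_in by (auto simp: clique2_def)

lemma finite_clique1 [simp]: "finite C1"
  using clique1_subset finite_subset pair_finite_verts by blast

lemma finite_clique2 [simp]: "finite C2"
  using clique2_subset finite_subset pair_finite_verts by blast

lemma cliques_union: "C1 \<union> C2 = V"
  using clique_cases clique1_subset clique2_subset by blast

text \<open>If two non-adjacent vertices both had their zeros below the diagonal, each would have a
  smaller index than the other. Hence \<open>C1\<close> is a clique and all non-neighbours of its
  members lie in \<open>C2\<close>.\<close>

lemma non_nbhd_clique1:
  assumes "x \<in> C1"
  shows "non_nbhd x \<subseteq> C2"
proof
  fix y assume y: "y \<in> non_nbhd x"
  have yV: "y \<in> V"
    using y non_nbhd_subset by blast
  have "y \<notin> C1"
  proof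
    assume "y \<in> C1"
    then obtain j where j: "j \<in> {1..n}" "y = v j" "\<forall>i\<in>zero_rows G v j. j < i"
      unfolding clique1_def by blast
    obtain i where i: "i \<in> {1..n}" "x = v i" "\<forall>j\<in>zero_rows G v i. i < j"
      using assms unfolding clique1_def by blast
    have "j \<in> zero_rows G v i" "i \<in> zero_rows G v j"
      using mem_zero_rows_iff i j y non_nbhd_sym[OF v_in[OF i(1)]] by auto
    then show False
      using i(3) j(3) by fastforce
  qed
  then show "y \<in> C2"
    using clique_cases[OF yV] by blast
qed

text \<open>The mirror image: here each index would exceed the other.\<close>

lemma non_nbhd_clique2:
  assumes "x \<in> C2"
  shows "non_nbhd x \<subseteq> C1"
proof
  fix y assume y: "y \<in> non_nbhd x"
  have yV: "y \<in> V"
    using y non_nbhd_subset by blast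
  have "y \<notin> C2"
  proof
    assume "y \<in> C2"
    then obtain j where j: "j \<in> {1..n}" "y = v j" "\<forall>i\<in>zero_rows G v j. i < j"
      unfolding clique2_def by blast
    obtain i where i: "i \<in> {1..n}" "x = v i" "\<forall>j\<in>zero_rows G v i. j < i"
      using assms unfolding clique2_def by blast
    have "j \<in> zero_rows G v i" "i \<in> zero_rows G v j"
      using mem_zero_rows_iff i j y non_nbhd_sym[OF v_in[OF i(1)]] by auto
    then show False
      using i(3) j(3) by fastforce
  qed
  then show "y \<in> C1"
    using clique_cases[OF yV] by blast
qed

lemma non_nbhd_cases:
  assumes "x \<in> V"
  obtains "non_nbhd x \<subseteq> C1" | "non_nbhd x \<subseteq> C2"
  using clique_cases[OF assms] non_nbhd_clique1 non_nbhd_clique2 by blast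

text \<open>A vertex and any of its non-neighbours lie in different cliques.\<close>

lemma cliques_nonempty:
  assumes "V \<noteq> {}"
  shows "C1 \<noteq> {}" "C2 \<noteq> {}"
proof -
  obtain x where x: "x \<in> V"
    using assms by blast
  obtain y where y: "y \<in> non_nbhd x"
    using non_nbhd_nonempty[OF x] by blast
  show "C1 \<noteq> {}" "C2 \<noteq> {}"
    using clique_cases[OF x] y non_nbhd_clique1 non_nbhd_clique2 by blast+
qed

section \<open>Auxiliary interval graphs and the Helly property\<close>

lemma pverts_interval_graph_on [simp]: "pverts (interval_graph_on G v C) = C"
  by (simp add: interval_graph_on_def)

text \<open>A column interval equals its zero set, so a common row is a common non-neighbour. This
  removes the numbering from the auxiliary graphs.\<close>

lemma interval_graph_on_arc_iff:
  assumes "C \<subseteq> V"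
  shows "(x, y) \<in> parcs (interval_graph_on G v C) \<longleftrightarrow>
    x \<in> C \<and> y \<in> C \<and> x \<noteq> y \<and> non_nbhd x \<inter> non_nbhd y \<noteq> {}"
proof -
  have meet: "column_interval G v i \<inter> column_interval G v j \<noteq> {} \<longleftrightarrow>
      non_nbhd (v i) \<inter> non_nbhd (v j) \<noteq> {}" if "i \<in> {1..n}" "j \<in> {1..n}" for i j
  proof -
    have "column_interval G v i \<inter> column_interval G v j \<noteq> {} \<longleftrightarrow>
        (\<exists>l\<in>{1..n}. v l \<in> non_nbhd (v i) \<and> v l \<in> non_nbhd (v j))"
      unfolding column_interval_eq[OF that(1)] column_interval_eq[OF that(2)]
      using mem_zero_rows_iff that zero_rows_subset[of i] by blast
    also have "\<dots> \<longleftrightarrow> (\<exists>z\<in>V. z \<in> non_nbhd (v i) \<and> z \<in> non_nbhd (v j))"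
      using v_in obtain_index by metis
    also have "\<dots> \<longleftrightarrow> non_nbhd (v i) \<inter> non_nbhd (v j) \<noteq> {}"
      using non_nbhd_subset by blast
    finally show ?thesis .
  qed
  show ?thesis (is "?L \<longleftrightarrow> ?R")
  proof
    assume ?L
    then obtain i j where "i \<in> {1..n}" "j \<in> {1..n}" "x = v i" "y = v j" "x \<in> C" "y \<in> C"
        "i \<noteq> j" "column_interval G v i \<inter> column_interval G v j \<noteq> {}"
      unfolding interval_graph_on_def by auto
    then show ?R
      using meet v_eq_iff by simp
  next
    assume R: ?R
    then have "x \<in> V" "y \<in> V"
      using assms by auto
    then obtain i j where "i \<in> {1..n}" "x = v i" "j \<in> {1..n}" "y = v j"
      by (metis obtain_index)
    then show ?L
      using R meet[of i j] by (auto simp: interval_graph_on_def)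
  qed
qed

text \<open>By symmetry of non-adjacency, \<open>z\<close> is a common non-neighbour of
  \<open>x\<close> and \<open>y\<close> iff both lie in \<open>non_nbhd z\<close>. The counting form
  can be compared directly with the domination inequality.\<close>

lemma independent_interval_graph_on_iff:
  assumes "C \<subseteq> V"
  shows "independent_set (interval_graph_on G v C) S \<longleftrightarrow>
    S \<subseteq> C \<and> (\<forall>z\<in>V. card (S \<inter> non_nbhd z) \<le> 1)"
proof (cases "S \<subseteq> C")
  case True
  have "independent_set (interval_graph_on G v C) S \<longleftrightarrow>
      (\<forall>x\<in>S. \<forall>y\<in>S. x \<noteq> y \<longrightarrow> non_nbhd x \<inter> non_nbhd y = {})"
    using True unfolding independent_set_def interval_graph_on_arc_iff[OF assms] by auto
  also have "\<dots> \<longleftrightarrow> (\<forall>z\<in>V. \<forall>x\<in>S \<inter> non_nbhd z. \<forall>y\<in>S \<inter> non_nbhd z. x = y)"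
    using True assms non_nbhd_sym non_nbhd_subset by blast
  also have "\<dots> \<longleftrightarrow> (\<forall>z\<in>V. card (S \<inter> non_nbhd z) \<le> 1)"
    by (simp add: card_le_Suc0_iff_eq)
  finally show ?thesis
    using True by simp
qed (simp add: independent_set_def)

lemma finite_interval_graph_on: "C \<subseteq> V \<Longrightarrow> finite (pverts (interval_graph_on G v C))"
  by (simp add: finite_subset)

text \<open>A singleton is independent.\<close>

lemma independence_number_pos:
  assumes "C \<subseteq> V" "C \<noteq> {}"
  shows "1 \<le> independence_number (interval_graph_on G v C)"
proof -
  obtain x where x: "x \<in> C"
    using assms by blast
  have "card ({x} \<inter> non_nbhd z) \<le> 1" for z
    using card_mono[of "{x}" "{x} \<inter> non_nbhd z"] by simp
  then have "independent_set (interval_graph_on G v C) {x}"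
    using independent_interval_graph_on_iff[OF assms(1)] x by simp
  then show ?thesis
    using independent_set_le_independence_number[OF finite_interval_graph_on[OF assms(1)]]
    by fastforce
qed

text \<open>
  The Helly property: the largest left endpoint of pairwise intersecting intervals lies in all of them.
\<close>

lemma common_non_neighbour:
  assumes C: "C \<subseteq> V" "C \<noteq> {}"
    and \<alpha>: "independence_number (interval_graph_on G v C) = 1"
  obtains u where "u \<in> V" "\<forall>x\<in>C. u \<in> non_nbhd x"
proof -
  let ?J = "{j \<in> {1..n}. v j \<in> C}"
  have meet: "zero_rows G v i \<inter> zero_rows G v j \<noteq> {}" if ij: "i \<in> ?J" "j \<in> ?J" for i j
  proof (cases "i = j")
    case True
    then show ?thesis
      using ij zero_rows_nonempty by blast
  next
    case False
    then have ne: "v i \<noteq> v j"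
      using ij v_eq_iff by blast
    \<comment> \<open>An independent pair would push the independence number above 1.\<close>
    have "\<not> independent_set (interval_graph_on G v C) {v i, v j}"
      using independent_set_le_independence_number[OF finite_interval_graph_on[OF C(1)]] \<alpha> ne
      by fastforce
    then have "non_nbhd (v i) \<inter> non_nbhd (v j) \<noteq> {}"
      using ij unfolding independent_set_def interval_graph_on_arc_iff[OF C(1)] by auto
    then obtain z where z: "z \<in> non_nbhd (v i)" "z \<in> non_nbhd (v j)"
      by blast
    then obtain l where "l \<in> {1..n}" "z = v l"
      using non_nbhd_subset obtain_index by blast
    then have "l \<in> zero_rows G v i" "l \<in> zero_rows G v j"
      using z ij mem_zero_rows_iff by blast+
    then show ?thesis by blast
  qed
  have "?J \<noteq> {}"
    using C obtain_index by blast
  define m where "m = Max ((\<lambda>j. Min (zero_rows G v j)) ` ?J)"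
  have "m \<in> (\<lambda>j. Min (zero_rows G v j)) ` ?J"
    unfolding m_def using \<open>?J \<noteq> {}\<close> by (intro Max_in) auto
  then obtain i where i: "i \<in> ?J" "m = Min (zero_rows G v i)"
    by blast
  have m: "m \<in> zero_rows G v j" if j: "j \<in> ?J" for j
  proof -
    have j': "j \<in> {1..n}" and i': "i \<in> {1..n}"
      using i j by auto
    obtain a b where ab: "a \<le> b" "zero_rows G v i = {a..b}"
      using i' by (rule zero_rows_eq_atLeastAtMost)
    obtain c d where cd: "c \<le> d" "zero_rows G v j = {c..d}"
      using j' by (rule zero_rows_eq_atLeastAtMost)
    have "Min (zero_rows G v j) \<le> m"
      unfolding m_def using j by (intro Max_ge) auto
    then have "c \<le> m"
      using cd by (simp add: Min_atLeastAtMost_nat)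
    moreover have "m = a"
      using i ab by (simp add: Min_atLeastAtMost_nat)
    \<comment> \<open>The interval of \<open>i\<close> starts at \<open>m\<close>; since it meets
      \<open>{c..d}\<close>, that interval cannot end before \<open>m\<close>.\<close>
    moreover have "a \<le> d"
      using meet[OF i(1) j] ab cd by auto
    ultimately show ?thesis
      using cd by simp
  qed
  show ?thesis
  proof
    have mn: "m \<in> {1..n}"
      using m[OF i(1)] zero_rows_subset by blast
    then show "v m \<in> V"
      by (rule v_in)
    show "\<forall>x\<in>C. v m \<in> non_nbhd x"
    proof
      fix x assume x: "x \<in> C"
      then obtain j where j: "j \<in> {1..n}" "x = v j"
        using C(1) obtain_index by blast
      then show "v m \<in> non_nbhd x"
        using m[of j] x mem_zero_rows_iff[OF mn j(1)] by simp
    qed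
  qed
qed

section \<open>Tuple domination counted through non-neighbours\<close>

text \<open>\<open>D\<close> splits into its parts inside and outside the closed neighbourhood of
  \<open>x\<close>. The additive form avoids truncated subtraction.\<close>

lemma tuple_dominating_iff:
  "tuple_dominating G k D \<longleftrightarrow> D \<subseteq> V \<and> (\<forall>x\<in>V. k + card (D \<inter> non_nbhd x) \<le> card D)"
proof (cases "D \<subseteq> V")
  case True
  have "card (closed_nbhd G x \<inter> D) + card (D \<inter> non_nbhd x) = card D" for x
  proof -
    have fin: "finite D"
      using True finite_subset pair_finite_verts by blast
    have D: "D = (closed_nbhd G x \<inter> D) \<union> (D \<inter> non_nbhd x)"
      using True by (auto simp: non_nbhd_def)
    have "card ((closed_nbhd G x \<inter> D) \<union> (D \<inter> non_nbhd x)) =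
        card (closed_nbhd G x \<inter> D) + card (D \<inter> non_nbhd x)"
      using fin by (intro card_Un_disjoint) (auto simp: non_nbhd_def)
    then show ?thesis
      using D by simp
  qed
  then have "k \<le> card (closed_nbhd G x \<inter> D) \<longleftrightarrow> k + card (D \<inter> non_nbhd x) \<le> card D" for x
    by (metis add_le_cancel_right)
  then show ?thesis
    using True by (simp add: tuple_dominating_def)
qed (simp add: tuple_dominating_def)

text \<open>As \<open>1 \<le> k\<close>, the set \<open>D\<close> has a member \<open>d\<close>. Any
  non-neighbour \<open>x\<close> of \<open>d\<close> must find its \<open>k\<close> dominators in
  \<open>D\<close> without \<open>d\<close>.\<close>

lemma tuple_dominating_card_gt:
  assumes "V \<noteq> {}" "1 \<le> k" "tuple_dominating G k D"
  shows "k + 1 \<le> card D"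
proof -
  have D: "D \<subseteq> V" and le: "\<And>x. x \<in> V \<Longrightarrow> k + card (D \<inter> non_nbhd x) \<le> card D"
    using assms(3) by (auto simp: tuple_dominating_iff)
  have "D \<noteq> {}"
    using assms(1,2) le by fastforce
  then obtain d where d: "d \<in> D" by blast
  then obtain x where x: "x \<in> non_nbhd d"
    using D non_nbhd_nonempty by blast
  then have "x \<in> V" "d \<in> D \<inter> non_nbhd x"
    using non_nbhd_subset non_nbhd_sym d D by auto
  then have "card (D \<inter> non_nbhd x) \<noteq> 0"
    by auto
  then show ?thesis
    using le[OF \<open>x \<in> V\<close>] by linarith
qed

lemma card_inter_cliques:
  assumes "D \<subseteq> V"
  shows "card D = card (D \<inter> C1) + card (D \<inter> C2)"
proof -
  have "D = (D \<inter> C1) \<union> (D \<inter> C2)"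
    using assms cliques_union by blast
  then have "card D = card ((D \<inter> C1) \<union> (D \<inter> C2))"
    by simp
  also have "\<dots> = card (D \<inter> C1) + card (D \<inter> C2)"
    using cliques_disjoint by (intro card_Un_disjoint) auto
  finally show ?thesis .
qed

text \<open>The non-neighbours of \<open>x\<close> lie in a single clique, so only one of the two
  parts contributes and the bound is not doubled.\<close>

lemma card_union_non_nbhd_le:
  assumes "S1 \<subseteq> C1" "S2 \<subseteq> C2" "x \<in> V"
    and "card (S1 \<inter> non_nbhd x) \<le> m" "card (S2 \<inter> non_nbhd x) \<le> m"
  shows "card ((S1 \<union> S2) \<inter> non_nbhd x) \<le> m"
  using assms(3)
proof (cases rule: non_nbhd_cases)
  case 1
  then have "(S1 \<union> S2) \<inter> non_nbhd x = S1 \<inter> non_nbhd x"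
    using assms(2) cliques_disjoint by blast
  then show ?thesis using assms(4) by simp
next
  case 2
  then have "(S1 \<union> S2) \<inter> non_nbhd x = S2 \<inter> non_nbhd x"
    using assms(1) cliques_disjoint by blast
  then show ?thesis using assms(5) by simp
qed

section \<open>The bounds and values of the tuple domination number\<close>

abbreviation "\<alpha>1 \<equiv> independence_number (aux_graph1 G v)"
abbreviation "\<alpha>2 \<equiv> independence_number (aux_graph2 G v)"

lemma closed_nbhd_eq_clique2:
  assumes "V \<noteq> {}" "\<alpha>1 = 1"
  obtains u where "u \<in> V" "closed_nbhd G u = C2"
proof -
  obtain u where u: "u \<in> V" "\<forall>x\<in>C1. u \<in> non_nbhd x"
    using common_non_neighbour[OF clique1_subset] cliques_nonempty[OF assms(1)] assms(2)
    unfolding aux_graph1_def by blast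
  have "C1 \<subseteq> non_nbhd u"
    using u non_nbhd_sym clique1_subset by blast
  \<comment> \<open>Being a non-neighbour of some member of \<open>C1\<close> puts \<open>u\<close>
    in the opposite clique, which bounds \<open>non_nbhd u\<close> from above by
    \<open>C1\<close>.\<close>
  moreover have "u \<in> C2"
    using u non_nbhd_clique1 cliques_nonempty[OF assms(1)] by blast
  ultimately have "non_nbhd u = C1"
    using non_nbhd_clique2 by blast
  moreover have "closed_nbhd G u \<subseteq> V"
    using u in_arcsD2 by (auto simp: closed_nbhd_def)
  ultimately have "closed_nbhd G u = V - C1"
    by (auto simp: non_nbhd_def)
  then show ?thesis
    using that[OF u(1)] cliques_union cliques_disjoint by blast
qed

lemma closed_nbhd_eq_clique1:
  assumes "V \<noteq> {}" "\<alpha>2 = 1"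
  obtains u where "u \<in> V" "closed_nbhd G u = C1"
proof -
  obtain u where u: "u \<in> V" "\<forall>x\<in>C2. u \<in> non_nbhd x"
    using common_non_neighbour[OF clique2_subset] cliques_nonempty[OF assms(1)] assms(2)
    unfolding aux_graph2_def by blast
  have "C2 \<subseteq> non_nbhd u"
    using u non_nbhd_sym clique2_subset by blast
  moreover have "u \<in> C1"
    using u non_nbhd_clique2 cliques_nonempty[OF assms(1)] by blast
  ultimately have "non_nbhd u = C2"
    using non_nbhd_clique1 by blast
  moreover have "closed_nbhd G u \<subseteq> V"
    using u in_arcsD2 by (auto simp: closed_nbhd_def)
  ultimately have "closed_nbhd G u = V - C2"
    by (auto simp: non_nbhd_def)
  then show ?thesis
    using that[OF u(1)] cliques_union cliques_disjoint by blast
qed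

text \<open>The vertex whose closed neighbourhood is exactly \<open>C2\<close> can only be dominated
  from \<open>C2\<close>.\<close>

lemma card_inter_clique2_ge:
  assumes "V \<noteq> {}" "\<alpha>1 = 1" "tuple_dominating G k D"
  shows "k \<le> card (D \<inter> C2)"
  using closed_nbhd_eq_clique2[OF assms(1,2)] assms(3)
  by (metis Int_commute tuple_dominating_def)

lemma card_inter_clique1_ge:
  assumes "V \<noteq> {}" "\<alpha>2 = 1" "tuple_dominating G k D"
  shows "k \<le> card (D \<inter> C1)"
  using closed_nbhd_eq_clique1[OF assms(1,2)] assms(3)
  by (metis Int_commute tuple_dominating_def)

text \<open>Any \<open>k\<close> vertices from each clique suffice, as each vertex misses at most
  the \<open>k\<close> chosen on one side. The lower bound adds the two clique bounds.\<close>

lemma tuple_domination_number_eq_double: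
  assumes "V \<noteq> {}" "\<alpha>1 + \<alpha>2 = 2" "k \<le> min_degree G + 1"
  shows "tuple_domination_number G k = 2 * k"
proof -
  have "1 \<le> \<alpha>1" "1 \<le> \<alpha>2"
    using independence_number_pos clique1_subset clique2_subset cliques_nonempty[OF assms(1)]
    by (auto simp: aux_graph1_def aux_graph2_def)
  then have \<alpha>: "\<alpha>1 = 1" "\<alpha>2 = 1"
    using assms(2) by auto
  \<comment> \<open>Each clique is itself a closed neighbourhood, so it has at least
    \<open>min_degree G + 1\<close> elements.\<close>
  have "k \<le> card C1" "k \<le> card C2"
    using closed_nbhd_eq_clique1[OF assms(1) \<alpha>(2)] closed_nbhd_eq_clique2[OF assms(1) \<alpha>(1)]
      card_closed_nbhd assms(3) by (metis order_trans)+
  then obtain D1 D2 where D: "D1 \<subseteq> C1" "card D1 = k" "D2 \<subseteq> C2" "card D2 = k"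
    by (meson obtain_subset_with_card_n)
  have fin: "finite D1" "finite D2"
    using D finite_subset finite_clique1 finite_clique2 by blast+
  have card: "card (D1 \<union> D2) = 2 * k"
    using card_Un_disjoint[OF fin] D cliques_disjoint by fastforce
  have dom: "tuple_dominating G k (D1 \<union> D2)"
    unfolding tuple_dominating_iff
  proof (intro conjI ballI)
    show "D1 \<union> D2 \<subseteq> V"
      using D clique1_subset clique2_subset by blast
    fix x assume x: "x \<in> V"
    have "card (D1 \<inter> non_nbhd x) \<le> k" "card (D2 \<inter> non_nbhd x) \<le> k"
      using card_mono[OF fin(1)] card_mono[OF fin(2)] D by (metis inf_le1)+
    then have "card ((D1 \<union> D2) \<inter> non_nbhd x) \<le> k"
      using card_union_non_nbhd_le D x by blast
    then show "k + card ((D1 \<union> D2) \<inter> non_nbhd x) \<le> card (D1 \<union> D2)"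
      using card by simp
  qed
  show ?thesis
  proof (rule tuple_domination_number_eqI[OF dom card])
    fix D assume D: "tuple_dominating G k D"
    then have "card D = card (D \<inter> C1) + card (D \<inter> C2)"
      by (intro card_inter_cliques) (simp add: tuple_dominating_iff)
    then show "2 * k \<le> card D"
      using card_inter_clique1_ge[OF assms(1) \<alpha>(2) D] card_inter_clique2_ge[OF assms(1) \<alpha>(1) D]
      by simp
  qed
qed

lemma maximum_independent_sets:
  obtains S1 S2 where "S1 \<subseteq> C1" "S2 \<subseteq> C2" "card S1 = \<alpha>1" "card S2 = \<alpha>2"
    "\<And>x. x \<in> V \<Longrightarrow> card (S1 \<inter> non_nbhd x) \<le> 1"
    "\<And>x. x \<in> V \<Longrightarrow> card (S2 \<inter> non_nbhd x) \<le> 1"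
proof -
  obtain S1 S2 where "independent_set (aux_graph1 G v) S1" "card S1 = \<alpha>1"
      "independent_set (aux_graph2 G v) S2" "card S2 = \<alpha>2"
    using independence_number_attained finite_interval_graph_on clique1_subset clique2_subset
    unfolding aux_graph1_def aux_graph2_def by metis
  then show ?thesis
    using that independent_interval_graph_on_iff clique1_subset clique2_subset
    unfolding aux_graph1_def aux_graph2_def by metis
qed

text \<open>Any \<open>k + 1\<close> vertices from the union of two maximum independent sets work:
  every vertex misses at most one of them.\<close>

lemma tuple_domination_number_eq_add_one:
  assumes "V \<noteq> {}" "1 \<le> k" "k < \<alpha>1 + \<alpha>2"
  shows "tuple_domination_number G k = k + 1"
proof -
  obtain S1 S2 where S: "S1 \<subseteq> C1" "S2 \<subseteq> C2" "card S1 = \<alpha>1" "card S2 = \<alpha>2"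
      "\<And>x. x \<in> V \<Longrightarrow> card (S1 \<inter> non_nbhd x) \<le> 1"
      "\<And>x. x \<in> V \<Longrightarrow> card (S2 \<inter> non_nbhd x) \<le> 1"
    using maximum_independent_sets by blast
  have "finite S1" "finite S2"
    using S finite_subset finite_clique1 finite_clique2 by blast+
  then have "card (S1 \<union> S2) = \<alpha>1 + \<alpha>2"
    using card_Un_disjoint[of S1 S2] S cliques_disjoint by fastforce
  then obtain D where D: "D \<subseteq> S1 \<union> S2" "card D = k + 1"
    using assms(3) obtain_subset_with_card_n[of "k + 1" "S1 \<union> S2"] by auto
  have "tuple_dominating G k D"
    unfolding tuple_dominating_iff
  proof (intro conjI ballI)
    show "D \<subseteq> V"
      using D S clique1_subset clique2_subset by blast
    fix x assume x: "x \<in> V"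
    have "card (D \<inter> non_nbhd x) \<le> card ((S1 \<union> S2) \<inter> non_nbhd x)"
      using D by (intro card_mono) auto
    also have "\<dots> \<le> 1"
      using card_union_non_nbhd_le S x by blast
    finally show "k + card (D \<inter> non_nbhd x) \<le> card D"
      using D by simp
  qed
  then show ?thesis
    using tuple_domination_number_eqI[OF _ D(2)] tuple_dominating_card_gt assms(1,2) by blast
qed

text \<open>The union of two maximum independent sets has only \<open>k\<close> vertices; one
  further vertex from each clique makes \<open>k + 2\<close>, and then every vertex misses at most
  two.\<close>

lemma tuple_domination_number_eq_add_two:
  assumes "V \<noteq> {}" "1 \<le> k" "\<alpha>1 + \<alpha>2 = k" "\<alpha>1 + 1 \<le> card C1" "\<alpha>2 + 1 \<le> card C2"
  shows "tuple_domination_number G k = k + 2"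
proof -
  obtain S1 S2 where S: "S1 \<subseteq> C1" "S2 \<subseteq> C2" "card S1 = \<alpha>1" "card S2 = \<alpha>2"
      "\<And>x. x \<in> V \<Longrightarrow> card (S1 \<inter> non_nbhd x) \<le> 1"
      "\<And>x. x \<in> V \<Longrightarrow> card (S2 \<inter> non_nbhd x) \<le> 1"
    using maximum_independent_sets by blast
  have fin: "finite S1" "finite S2"
    using S finite_subset finite_clique1 finite_clique2 by blast+
  \<comment> \<open>The size hypotheses on the cliques provide the extra vertices \<open>a\<close>
    and \<open>b\<close>.\<close>
  have "S1 \<noteq> C1" "S2 \<noteq> C2"
    using S assms(4,5) by auto
  then obtain a b where a: "a \<in> C1" "a \<notin> S1" and b: "b \<in> C2" "b \<notin> S2"
    using S by blast
  let ?T1 = "insert a S1" and ?T2 = "insert b S2"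
  have T: "?T1 \<subseteq> C1" "?T2 \<subseteq> C2"
    using S a b by auto
  have "card (?T1 \<union> ?T2) = card ?T1 + card ?T2"
    using fin T cliques_disjoint by (intro card_Un_disjoint) blast+
  then have card: "card (?T1 \<union> ?T2) = k + 2"
    using fin a b S assms(3) by simp
  have insert_le: "card (insert y S \<inter> N) \<le> 2" if "card (S \<inter> N) \<le> 1" "finite N"
    for y :: 'a and S N
    using that by (cases "y \<in> N") (auto simp: card_insert_if)
  have dom: "tuple_dominating G k (?T1 \<union> ?T2)"
    unfolding tuple_dominating_iff
  proof (intro conjI ballI)
    show "?T1 \<union> ?T2 \<subseteq> V"
      using T clique1_subset clique2_subset by blast
    fix x assume x: "x \<in> V"
    have "card ((?T1 \<union> ?T2) \<inter> non_nbhd x) \<le> 2"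
      by (rule card_union_non_nbhd_le[OF T x]; rule insert_le) (use S x in auto)
    then show "k + card ((?T1 \<union> ?T2) \<inter> non_nbhd x) \<le> card (?T1 \<union> ?T2)"
      using card by linarith
  qed
  show ?thesis
  proof (rule tuple_domination_number_eqI[OF dom card])
    fix D assume D: "tuple_dominating G k D"
    have DV: "D \<subseteq> V" and le: "\<And>x. x \<in> V \<Longrightarrow> k + card (D \<inter> non_nbhd x) \<le> card D"
      using D by (auto simp: tuple_dominating_iff)
    \<comment> \<open>With \<open>k + 1\<close> vertices both parts of \<open>D\<close> would be
      independent, giving at most \<open>\<alpha>1 + \<alpha>2 = k\<close> vertices.\<close>
    have "card D \<noteq> k + 1"
    proof
      assume k1: "card D = k + 1"
      have one: "card (D \<inter> C \<inter> non_nbhd x) \<le> 1" if "x \<in> V" for C x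
      proof -
        have "card (D \<inter> C \<inter> non_nbhd x) \<le> card (D \<inter> non_nbhd x)"
          by (intro card_mono) auto
        then show ?thesis
          using le[OF that] k1 by linarith
      qed
      have "card (D \<inter> C) \<le> independence_number (interval_graph_on G v C)" if "C \<subseteq> V" for C
        using that one independent_interval_graph_on_iff[OF that]
        by (intro independent_set_le_independence_number finite_interval_graph_on) auto
      then have "card (D \<inter> C1) \<le> \<alpha>1" "card (D \<inter> C2) \<le> \<alpha>2"
        using clique1_subset clique2_subset by (auto simp: aux_graph1_def aux_graph2_def)
      then show False
        using card_inter_cliques[OF DV] k1 assms(3) by linarith
    qed
    then show "k + 2 \<le> card D"
      using tuple_dominating_card_gt[OF assms(1,2) D] by linarith
  qed
qed

end

theorem theorem4p6:
  fixes G :: "'a pair_pre_digraph"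
    and v :: "nat \<Rightarrow> 'a"
    and C1 C2 :: "'a set"
    and \<alpha>1 \<alpha>2 k :: nat
  assumes "pair_graph G"
    and "Digraph_Component.connected (with_proj G)"
    and "co_biconvex G"
    and "\<not> (\<exists>u. universal_vertex G u)"
    and "co_biconvex_ordering G v"
    and "C1 = clique1 G v" and "C2 = clique2 G v"
    and "\<alpha>1 = independence_number (aux_graph1 G v)"
    and "\<alpha>2 = independence_number (aux_graph2 G v)"
    and "1 \<le> k" and "k \<le> min_degree G + 1"
  shows "(\<alpha>1 = 1 \<longrightarrow> (\<forall>D. tuple_dominating G k D \<longrightarrow> k \<le> card (D \<inter> C2))) \<and>
         (\<alpha>2 = 1 \<longrightarrow> (\<forall>D. tuple_dominating G k D \<longrightarrow> k \<le> card (D \<inter> C1))) \<and>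
         (\<alpha>1 + \<alpha>2 = 2 \<longrightarrow> tuple_domination_number G k = 2 * k) \<and>
         (\<alpha>1 + \<alpha>2 > k \<longrightarrow> tuple_domination_number G k = k + 1) \<and>
         (\<alpha>1 + \<alpha>2 = k \<and> card C1 \<ge> \<alpha>1 + 1 \<and> card C2 \<ge> \<alpha>2 + 1
            \<longrightarrow> tuple_domination_number G k = k + 2)"
proof -
  interpret co_biconvex_graph G v
    using assms(1,4,5) by (simp add: co_biconvex_graph_def co_biconvex_graph_axioms_def)
  \<comment> \<open>Connectedness as defined in the library includes having a vertex.\<close>
  have "pverts G \<noteq> {}"
    using assms(2) by (auto simp: connected_def strongly_connected_def)
  then show ?thesis
    using card_inter_clique1_ge card_inter_clique2_ge tuple_domination_number_eq_double
      tuple_domination_number_eq_add_one tuple_domination_number_eq_add_two assms(10,11)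
    unfolding assms(6-9) by simp
qed

end
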